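(* Let $(M;c)$ be a coloured matroid and let $k\ge2$ be an integer. If $r(M)\ge k$ and $|c(F)|\le k$ for every rank-$k$ flat $F$ of $M$, then either $|c|\le k$ or $(M;c)$ has no rainbow triangle.
   Context: A coloured matroid $(M;c)$ is a (finite) matroid $M$ together with a function $c$ on $E(M)$; $c(X)$ is the set of colours on $X$ and $|c|$ is the number of colours used by $c$ on $E(M)$. A set is rainbow if $c$ is injective on it; a triangle is a three-element circuit. *)

theory Defs
  imports Main
begin

(* A finite matroid, given by its ground set E and its independent sets. *)
locale matroid =
  fixes E :: "'a set" and indep :: "'a set \<Rightarrow> bool"
  assumes finite_ground: "finite E"
    and indep_ground: "indep I \<Longrightarrow> I \<subseteq> E"
    and indep_empty: "indep {}"
    and indep_mono: "indep J \<Longrightarrow> I \<subseteq> J \<Longrightarrow> indep I"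
    and indep_augment:
      "indep I \<Longrightarrow> indep J \<Longrightarrow> card I < card J \<Longrightarrow> \<exists>e \<in> J - I. indep (insert e I)"

(* The definitions take the matroid data explicitly; they have their intended
   meaning when "matroid E indep" holds. *)

definition rank :: "('a set \<Rightarrow> bool) \<Rightarrow> 'a set \<Rightarrow> nat" where
  "rank indep X = Max {card I |I. I \<subseteq> X \<and> indep I}"

definition closure :: "'a set \<Rightarrow> ('a set \<Rightarrow> bool) \<Rightarrow> 'a set \<Rightarrow> 'a set" where
  "closure E indep X = {e \<in> E. rank indep (insert e X) = rank indep X}"

definition flat :: "'a set \<Rightarrow> ('a set \<Rightarrow> bool) \<Rightarrow> 'a set \<Rightarrow> bool" where
  "flat E indep F \<longleftrightarrow> F \<subseteq> E \<and> closure E indep F = F"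

definition circuit :: "'a set \<Rightarrow> ('a set \<Rightarrow> bool) \<Rightarrow> 'a set \<Rightarrow> bool" where
  "circuit E indep C \<longleftrightarrow> C \<subseteq> E \<and> \<not> indep C \<and> (\<forall>D. D \<subset> C \<longrightarrow> indep D)"

definition triangle :: "'a set \<Rightarrow> ('a set \<Rightarrow> bool) \<Rightarrow> 'a set \<Rightarrow> bool" where
  "triangle E indep T \<longleftrightarrow> circuit E indep T \<and> card T = 3"

(* A colouring is a total HOL function; only its values on E matter. *)
definition rainbow :: "('a \<Rightarrow> 'c) \<Rightarrow> 'a set \<Rightarrow> bool" where
  "rainbow c X \<longleftrightarrow> inj_on c X"

end

(* Adding k - 2 elements of further colours to a rainbow triangle, which has rank
   two, gives a set of rank at most k with k + 1 colours.  A maximal superset of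
   rank at most k is a flat of rank exactly k, and it has too many colours. *)
theory Submission
  imports Defs
begin

context matroid
begin

lemma indep_finite: "indep I \<Longrightarrow> finite I"
  using finite_ground indep_ground finite_subset by blast

text \<open>The set under \<open>Max\<close> is nonempty, as \<open>{}\<close> is independent, and
  finite, as \<open>card E\<close> bounds its members. Upper bounds on rank thus become statements
  about single independent sets.\<close>

lemma rank_le_iff: "rank indep X \<le> n \<longleftrightarrow> (\<forall>I. I \<subseteq> X \<longrightarrow> indep I \<longrightarrow> card I \<le> n)"
proof -
  let ?A = "{card I |I. I \<subseteq> X \<and> indep I}"
  have "?A \<subseteq> {..card E}"
    using card_mono finite_ground indep_ground by blast
  then have "finite ?A"
    using finite_subset by blast
  moreover have "?A \<noteq> {}"
    using indep_empty by blast
  ultimately show ?thesis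
    unfolding rank_def by (subst Max_le_iff) auto
qed

lemma card_le_rank: "I \<subseteq> X \<Longrightarrow> indep I \<Longrightarrow> card I \<le> rank indep X"
  using rank_le_iff by blast

lemma rank_le_card: "finite X \<Longrightarrow> rank indep X \<le> card X"
  by (simp add: rank_le_iff card_mono)

text \<open>An independent subset of the union splits into its part in \<open>X\<close> and the
  rest, which lies in \<open>Y\<close>; both parts are again independent.\<close>

lemma rank_Un_le: "rank indep (X \<union> Y) \<le> rank indep X + rank indep Y"
  unfolding rank_le_iff[of "X \<union> Y"]
proof (intro allI impI)
  fix I assume I: "I \<subseteq> X \<union> Y" "indep I"
  have "card I = card (I \<inter> X) + card (I - X)"
    using I(2) indep_finite card_Int_Diff by blast
  also have "\<dots> \<le> rank indep X + rank indep Y"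
    using I by (intro add_mono card_le_rank) (auto intro: indep_mono)
  finally show "card I \<le> rank indep X + rank indep Y" .
qed

lemma rank_insert_le: "rank indep (insert e X) \<le> Suc (rank indep X)"
  using rank_Un_le[of "{e}" X] rank_le_card[of "{e}"] by simp

text \<open>A circuit is dependent, so its independent subsets are all proper. For a triangle this
  gives rank at most two.\<close>

lemma rank_circuit_less:
  assumes "circuit E indep C"
  shows "rank indep C < card C"
proof -
  have C: "C \<subseteq> E" "\<not> indep C"
    using assms by (auto simp: circuit_def)
  then have fin: "finite C"
    using finite_ground finite_subset by blast
  have lt: "card I < card C" if "I \<subseteq> C" "indep I" for I
    using that C fin by (intro psubset_card_mono psubsetI) auto
  \<comment> \<open>Positivity makes the truncated \<open>card C - 1\<close> strictly smaller than
    \<open>card C\<close>.\<close>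
  have "card C > 0"
    using lt[of "{}"] indep_empty by simp
  moreover have "rank indep C \<le> card C - 1"
    unfolding rank_le_iff by (auto dest: lt)
  ultimately show ?thesis
    by simp
qed

text \<open>Take \<open>F\<close> maximal among the supersets of \<open>X\<close> of rank at most
  \<open>k\<close>. Any further element lifts the rank above \<open>k\<close>, so \<open>F\<close>
  is closed; as one element adds at most one to the rank, \<open>F\<close> already has rank
  \<open>k\<close>. If \<open>F = E\<close>, the bound \<open>k \<le> rank indep E\<close> gives
  this instead.\<close>

lemma flat_extension:
  assumes X: "X \<subseteq> E" "rank indep X \<le> k" and k: "k \<le> rank indep E"
  obtains F where "X \<subseteq> F" "flat E indep F" "rank indep F = k"
proof -
  let ?S = "{F. F \<subseteq> E \<and> rank indep F \<le> k}"
  have "finite ?S"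
    using finite_ground by simp
  then obtain F where F: "F \<in> ?S" "X \<subseteq> F" and max: "\<forall>G\<in>?S. F \<subseteq> G \<longrightarrow> F = G"
    using X finite_has_maximal2[of ?S X] by blast
  have gt: "k < rank indep (insert e F)" if "e \<in> E - F" for e
  proof (rule ccontr)
    assume "\<not> ?thesis"
    then have "insert e F \<in> ?S"
      using F that by simp
    then show False
      using max that by blast
  qed
  have "closure E indep F = F"
  proof (intro equalityI subsetI)
    fix e assume "e \<in> closure E indep F"
    then have "e \<in> E" "rank indep (insert e F) \<le> k"
      using F by (auto simp: closure_def)
    then show "e \<in> F"
      using gt[of e] by auto
  next
    fix e assume "e \<in> F"
    then show "e \<in> closure E indep F"
      using F by (auto simp: closure_def insert_absorb)
  qed
  then have "flat E indep F"
    using F by (simp add: flat_def)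
  moreover have "rank indep F = k"
  proof (cases "F = E")
    case True
    then show ?thesis
      using F k by auto
  next
    case False
    then obtain e where "e \<in> E - F"
      using F by blast
    then show ?thesis
      using gt[of e] rank_insert_le[of e F] F by simp
  qed
  ultimately show ?thesis
    using that F by blast
qed

end

theorem theorem5p3:
  fixes E :: "'a set" and indep :: "'a set \<Rightarrow> bool"
    and c :: "'a \<Rightarrow> 'c" and k :: nat
  assumes "matroid E indep"
    and "k \<ge> 2"
    and "rank indep E \<ge> k"
    and "\<And>F. flat E indep F \<Longrightarrow> rank indep F = k \<Longrightarrow> card (c ` F) \<le> k"
  shows "card (c ` E) \<le> k \<or> \<not> (\<exists>T. triangle E indep T \<and> rainbow c T)"
proof (rule ccontr)
  interpret matroid E indep by fact
  assume "\<not> ?thesis"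
  then obtain T where many: "k < card (c ` E)" and circ: "circuit E indep T"
    and card_T: "card T = 3" and "inj_on c T"
    by (auto simp: triangle_def rainbow_def)
  have T: "T \<subseteq> E" "finite T"
    using circ finite_ground finite_subset by (auto simp: circuit_def)
  have card_cT: "card (c ` T) = 3"
    using \<open>inj_on c T\<close> card_T by (simp add: card_image)
  \<comment> \<open>At least \<open>k + 1\<close> colours occur on \<open>E\<close>, and exactly
    three of them on \<open>T\<close>.\<close>
  have "k - 2 \<le> card (c ` E - c ` T)"
    using many card_cT T by (subst card_Diff_subset) auto
  then obtain S where S: "S \<subseteq> c ` E - c ` T" "card S = k - 2" "finite S"
    using obtain_subset_with_card_n by metis
  \<comment> \<open>\<open>U\<close> picks one element for each colour in \<open>S\<close>, so its
    size, and hence its rank, is at most \<open>k - 2\<close>.\<close>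
  then obtain U where U: "U \<subseteq> E" "inj_on c U" "S = c ` U"
    using subset_image_inj[of S c E] by blast
  have card_U: "card U = k - 2" and fin_U: "finite U"
    using S U by (auto simp: card_image finite_image_iff)
  \<comment> \<open>The bound is 2 + (k - 2), which equals \<open>k\<close> because
    \<open>k \<ge> 2\<close> rules out truncation.\<close>
  have "rank indep (T \<union> U) \<le> k"
    using rank_Un_le[of T U] rank_circuit_less[OF circ] rank_le_card[OF fin_U]
      card_T card_U \<open>k \<ge> 2\<close> by linarith
  then obtain F where F: "T \<union> U \<subseteq> F" "flat E indep F" "rank indep F = k"
    using flat_extension[of "T \<union> U" k] T U \<open>rank indep E \<ge> k\<close> by blast
  \<comment> \<open>\<open>S\<close> avoids the colours of \<open>T\<close>, so the count is 3 + (k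
    - 2) = k + 1, one more than a flat of rank \<open>k\<close> may carry.\<close>
  have "card (c ` (T \<union> U)) = card (c ` T) + card S"
    unfolding image_Un U(3)[symmetric] using S T by (intro card_Un_disjoint) auto
  moreover have "card (c ` (T \<union> U)) \<le> card (c ` F)"
    using F finite_ground by (intro card_mono finite_imageI image_mono)
      (auto simp: flat_def intro: finite_subset)
  ultimately show False
    using assms(4)[OF F(2,3)] card_cT S(2) \<open>k \<ge> 2\<close> by simp
qed

end
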